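(* Let $m$ be an odd squarefree positive integer with $3\mid m$. Let $f:\mathbb{Z}_m^*\rightarrow(0,1]$ be an arbitrary function with average $\alpha$. For $i=1,2$, let $\alpha_i$ be the average of $f$ over those reduced residues $r\pmod m$ with $r\equiv i\pmod 3$. Suppose that $2\alpha_1+\alpha_2>3/2$ and $2\alpha_2+\alpha_1>3/2$. Then for any $x\in\mathbb{Z}_m$, there exist $a_1,a_2,a_3\in\mathbb{Z}_m^*$ with $x=a_1+a_2+a_3$, such that $$f(a_1)+f(a_2)+f(a_3)>\tfrac{3}{2}.$$
   Context: $\mathbb{Z}_m=\mathbb{Z}/m\mathbb{Z}$ and $\mathbb{Z}_m^*$ is the set of reduced residues (units) modulo $m$. The elements $a_1,a_2,a_3$ are not required to be distinct. *)

theory Defs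
  imports Complex_Main "HOL-Computational_Algebra.Squarefree" "HOL-Number_Theory.Residues"
begin

definition average :: "('a \<Rightarrow> real) \<Rightarrow> 'a set \<Rightarrow> real" where
  "average f A = (\<Sum>r\<in>A. f r) / real (card A)"

text \<open>
  The carrier of \<^term>\<open>residue_ring m\<close> is the set of representatives \<open>{0..m - 1}\<close>.
  When 3 divides \<open>m\<close>, the class modulo 3 of a residue modulo \<open>m\<close> is therefore the class
  modulo 3 of its representative.
\<close>

definition reduced_residues :: "int \<Rightarrow> int set" where
  "reduced_residues m = Units (residue_ring m)"

definition reduced_residues_mod3 :: "int \<Rightarrow> int \<Rightarrow> int set" where
  "reduced_residues_mod3 m i = {r \<in> reduced_residues m. [r = i] (mod 3)}"

end

theory Submission
  imports Defs
begin

text \<open>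
  For a prime \<open>p \<ge> 5\<close> and a residue \<open>x\<close>, give each triple of units with \<open>a + b + c = x\<close> the
  weight \<open>p - 1 - [a = x] - [b = x] - [c = x] \<ge> 0\<close>. These weights are symmetric and all their
  marginals are uniform, so three functions \<open>F\<close>, \<open>G\<close>, \<open>H\<close> on the units satisfy
  \<open>F a + G b + H c \<ge> avg F + avg G + avg H\<close> for some such triple. Averaging over the fibres of the
  Chinese remainder isomorphism makes this property multiplicative in the modulus, so it holds
  modulo \<open>m / 3\<close>. It then remains to pick three classes modulo 3 with sum \<open>x\<close>: the corresponding
  sum of averages is \<open>2\<alpha>\<^sub>1 + \<alpha>\<^sub>2\<close>, \<open>2\<alpha>\<^sub>2 + \<alpha>\<^sub>1\<close>, or the larger of \<open>3\<alpha>\<^sub>1\<close> and \<open>3\<alpha>\<^sub>2\<close>.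
\<close>

section \<open>Units modulo n and the Chinese remainder theorem\<close>

text \<open>Explicit integer representatives, with \<open>units_mod 1 = {0}\<close> nonempty, so
  that modulus 1 can serve as the base of the induction over prime factors.\<close>

definition units_mod :: "int \<Rightarrow> int set" where
  "units_mod n = {r \<in> {0..<n}. coprime r n}"

lemma finite_units_mod [simp]: "finite (units_mod n)"
  by (rule finite_subset[of _ "{0..<n}"]) (auto simp: units_mod_def)

lemma units_mod_nonempty: "n > 0 \<Longrightarrow> units_mod n \<noteq> {}"
proof -
  assume "n > 0"
  hence "1 mod n \<in> units_mod n"
    by (simp add: units_mod_def coprime_mod_left_iff)
  thus ?thesis by blast
qed

lemma units_mod_prime: "prime p \<Longrightarrow> units_mod p = {0<..<p}"
proof -
  assume p: "prime p"
  have "coprime r p \<longleftrightarrow> r \<noteq> 0" if "0 \<le> r" "r < p" for r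
  proof -
    have "coprime r p \<longleftrightarrow> \<not> p dvd r"
      using p by (metis coprime_absorb_right coprime_commute not_prime_unit prime_imp_coprime)
    also have "\<dots> \<longleftrightarrow> r \<noteq> 0" using that by (auto dest: zdvd_imp_le)
    finally show ?thesis .
  qed
  thus ?thesis by (auto simp: units_mod_def order.strict_iff_order)
qed

lemma reduced_residues_eq_units_mod:
  assumes "m > 1" shows "reduced_residues m = units_mod m"
proof -
  interpret residues m "residue_ring m" using assms by unfold_locales auto
  show ?thesis using assms
    by (auto simp: reduced_residues_def res_units_eq units_mod_def order.strict_iff_order)
qed

lemma squarefree_mult_imp_coprime:
  "squarefree (a * b) \<Longrightarrow> coprime a b"
  by (rule coprimeI) (metis mult_dvd_mono power2_eq_square squarefreeD)

text \<open>The inverse of \<open>c\<close> is \<open>r \<mapsto> (r mod a, r mod b)\<close>. The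
  map is returned curried, so that fixing one argument describes a fibre of reduction, while the
  bijection turns sums over the units modulo \<open>a * b\<close> into double sums.\<close>

lemma units_mod_mult_crt:
  fixes a b :: int
  assumes "a > 0" "b > 0" "coprime a b"
  obtains c where "\<And>i j. i \<in> units_mod a \<Longrightarrow> j \<in> units_mod b \<Longrightarrow>
      c i j \<in> units_mod (a * b) \<and> c i j mod a = i \<and> c i j mod b = j"
    and "bij_betw (\<lambda>(i, j). c i j) (units_mod a \<times> units_mod b) (units_mod (a * b))"
proof -
  have "\<exists>r. r \<in> units_mod (a * b) \<and> r mod a = i \<and> r mod b = j"
    if "i \<in> units_mod a" "j \<in> units_mod b" for i j
  proof -
    obtain y where y: "[y = i] (mod a)" "[y = j] (mod b)"
      using binary_chinese_remainder_int[OF assms(3)] by blast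
    define r where "r = y mod (a * b)"
    have r: "r mod a = i" "r mod b = j"
      using y that by (auto simp: r_def cong_def units_mod_def mod_mod_cancel)
    have "coprime r a" "coprime r b"
      using r that assms by (metis (no_types, lifting) coprime_mod_left_iff less_irrefl
          mem_Collect_eq units_mod_def)+
    moreover have "0 \<le> r" "r < a * b" using assms by (auto simp: r_def)
    ultimately show ?thesis using r by (auto simp: units_mod_def)
  qed
  then obtain c where c: "\<And>i j. i \<in> units_mod a \<Longrightarrow> j \<in> units_mod b \<Longrightarrow>
      c i j \<in> units_mod (a * b) \<and> c i j mod a = i \<and> c i j mod b = j"
    by metis
  have "bij_betw (\<lambda>(i, j). c i j) (units_mod a \<times> units_mod b) (units_mod (a * b))"
  proof (rule bij_betw_byWitness[where f' = "\<lambda>r. (r mod a, r mod b)"])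
    have *: "r mod a \<in> units_mod a \<and> r mod b \<in> units_mod b" if "r \<in> units_mod (a * b)" for r
      using that assms by (auto simp: units_mod_def coprime_mod_left_iff)
    show "(\<lambda>r. (r mod a, r mod b)) ` units_mod (a * b) \<subseteq> units_mod a \<times> units_mod b"
      using * by auto
    show "\<forall>r\<in>units_mod (a * b). (\<lambda>(i, j). c i j) (r mod a, r mod b) = r"
    proof
      fix r assume r: "r \<in> units_mod (a * b)"
      let ?s = "c (r mod a) (r mod b)"
      have s: "?s \<in> units_mod (a * b)" "[?s = r] (mod a)" "[?s = r] (mod b)"
        using c * r by (auto simp: cong_def)
      hence "[?s = r] (mod a * b)" using assms(3) coprime_cong_mult by blast
      thus "(\<lambda>(i, j). c i j) (r mod a, r mod b) = r"
        using s(1) r by (simp add: cong_def units_mod_def)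
    qed
  qed (use c in auto)
  with c that show thesis by blast
qed

section \<open>The averaging property and its multiplicativity\<close>

text \<open>Three independent functions are allowed because even a single function restricts to
  three different ones on three different fibres. Multiplying by the number of units avoids
  division.\<close>

definition ternary_average_attained :: "int \<Rightarrow> bool" where
  "ternary_average_attained n \<longleftrightarrow> (\<forall>(F :: int \<Rightarrow> real) G H x.
     \<exists>a\<in>units_mod n. \<exists>b\<in>units_mod n. \<exists>c\<in>units_mod n. [a + b + c = x] (mod n) \<and>
       sum F (units_mod n) + sum G (units_mod n) + sum H (units_mod n)
         \<le> real (card (units_mod n)) * (F a + G b + H c))"

lemma ternary_average_attainedE:
  assumes "ternary_average_attained n"
  obtains a b c where "a \<in> units_mod n" "b \<in> units_mod n" "c \<in> units_mod n"
    "[a + b + c = x] (mod n)"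
    "sum F (units_mod n) + sum G (units_mod n) + sum H (units_mod n)
       \<le> real (card (units_mod n)) * (F a + G b + H c)"
  using assms unfolding ternary_average_attained_def by metis

lemma ternary_average_attained_1: "ternary_average_attained 1"
proof -
  have "units_mod 1 = {0}" by (auto simp: units_mod_def)
  thus ?thesis by (simp add: ternary_average_attained_def)
qed

text \<open>The property is used twice: modulo \<open>b\<close> for the fibre sums, which selects
  three fibres, then modulo \<open>a\<close> inside these fibres. The two factors
  \<open>card\<close> multiply to the number of units modulo \<open>a * b\<close>.\<close>

lemma ternary_average_attained_mult:
  assumes "a > 0" "b > 0" "coprime a b"
    and "ternary_average_attained a" "ternary_average_attained b"
  shows "ternary_average_attained (a * b)"
  unfolding ternary_average_attained_def
proof (intro allI)
  fix F G H :: "int \<Rightarrow> real" and x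
  let ?U = "units_mod a" and ?V = "units_mod b"
  obtain c where c: "\<And>i j. i \<in> ?U \<Longrightarrow> j \<in> ?V \<Longrightarrow>
      c i j \<in> units_mod (a * b) \<and> c i j mod a = i \<and> c i j mod b = j"
    and bij: "bij_betw (\<lambda>(i, j). c i j) (?U \<times> ?V) (units_mod (a * b))"
    using units_mod_mult_crt[OF assms(1-3)] by blast
  define E where "E F j = (\<Sum>i\<in>?U. F (c i j))" for F :: "int \<Rightarrow> real" and j
  have sum_E: "sum (E F) ?V = sum F (units_mod (a * b))" for F
    unfolding E_def sum.swap[of _ ?U] sum.cartesian_product
      sum.reindex_bij_betw[OF bij, symmetric] by (simp add: case_prod_beta)
  have card: "card (units_mod (a * b)) = card ?U * card ?V"
    using bij_betw_same_card[OF bij] by (simp add: card_cartesian_product)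
  obtain j k l where j: "j \<in> ?V" "k \<in> ?V" "l \<in> ?V" "[j + k + l = x] (mod b)"
    "sum (E F) ?V + sum (E G) ?V + sum (E H) ?V \<le> real (card ?V) * (E F j + E G k + E H l)"
    using ternary_average_attainedE[OF assms(5)] .
  \<comment> \<open>The three functions are now the restrictions of \<open>F\<close>,
    \<open>G\<close>, \<open>H\<close> to the fibres over \<open>j\<close>, \<open>k\<close>,
    \<open>l\<close>.\<close>
  obtain r s t where r: "r \<in> ?U" "s \<in> ?U" "t \<in> ?U" "[r + s + t = x] (mod a)"
    "E F j + E G k + E H l \<le> real (card ?U) * (F (c r j) + G (c s k) + H (c t l))"
    unfolding E_def
    using ternary_average_attainedE[OF assms(4),
        of x "\<lambda>i. F (c i j)" "\<lambda>i. G (c i k)" "\<lambda>i. H (c i l)"] .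
  have "[c r j + c s k + c t l = r + s + t] (mod a)" "[c r j + c s k + c t l = j + k + l] (mod b)"
    using c r(1-3) j(1-3) by (auto intro!: cong_add simp: cong_def[of "c _ _"] units_mod_def)
  hence "[c r j + c s k + c t l = x] (mod a * b)"
    using r(4) j(4) assms(3) by (meson coprime_cong_mult cong_trans)
  moreover have "sum F (units_mod (a * b)) + sum G (units_mod (a * b)) + sum H (units_mod (a * b))
      \<le> real (card (units_mod (a * b))) * (F (c r j) + G (c s k) + H (c t l))"
    using order_trans[OF j(5) mult_left_mono[OF r(5)]]
    by (simp add: sum_E card mult_ac)
  ultimately show "\<exists>u\<in>units_mod (a * b). \<exists>v\<in>units_mod (a * b). \<exists>w\<in>units_mod (a * b).
     [u + v + w = x] (mod a * b) \<and>
       sum F (units_mod (a * b)) + sum G (units_mod (a * b)) + sum H (units_mod (a * b))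
         \<le> real (card (units_mod (a * b))) * (F u + G v + H w)"
    using c r j by blast
qed

section \<open>Averaging against a symmetric weight with uniform marginals\<close>

text \<open>Each summand depends on one variable only, so summing out the other two leaves the
  marginal \<open>K\<close>. Symmetry of \<open>W\<close> moves the second and third variables into
  the first place.\<close>

lemma sum_weighted_triples:
  fixes W :: "'a \<Rightarrow> 'a \<Rightarrow> 'a \<Rightarrow> real"
  assumes sym: "\<And>a b c. W a b c = W b a c" "\<And>a b c. W a b c = W a c b"
    and marg: "\<And>a. a \<in> U \<Longrightarrow> (\<Sum>b\<in>U. \<Sum>c\<in>U. W a b c) = K"
  shows "(\<Sum>a\<in>U. \<Sum>b\<in>U. \<Sum>c\<in>U. W a b c * (F a + G b + H c))
    = K * (sum F U + sum G U + sum H U)"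
proof -
  have first: "(\<Sum>a\<in>U. \<Sum>b\<in>U. \<Sum>c\<in>U. W a b c * F a) = K * sum F U" for F
    by (simp add: sum_distrib_right[symmetric] sum_distrib_left marg)
  have second: "(\<Sum>a\<in>U. \<Sum>b\<in>U. \<Sum>c\<in>U. W a b c * F b) = K * sum F U" for F
    by (subst sum.swap, subst sym(1)) (rule first)
  have third: "(\<Sum>a\<in>U. \<Sum>b\<in>U. \<Sum>c\<in>U. W a b c * F c) = K * sum F U" for F
    by (subst sum.swap[of _ U U], subst sym(2)) (rule second)
  show ?thesis
    unfolding distrib_left sum.distrib first second third by (rule refl)
qed

text \<open>If every triple of positive weight fell below the mean \<open>S\<close>, the weighted
  deficits \<open>?D\<close> would be nonnegative with sum zero, hence all zero. This forces
  \<open>W\<close> to vanish on \<open>U\<close>, against \<open>K > 0\<close>.\<close>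

lemma exists_triple_ge_average:
  fixes W :: "'a \<Rightarrow> 'a \<Rightarrow> 'a \<Rightarrow> real"
  assumes sym: "\<And>a b c. W a b c = W b a c" "\<And>a b c. W a b c = W a c b"
    and marg: "\<And>a. a \<in> U \<Longrightarrow> (\<Sum>b\<in>U. \<Sum>c\<in>U. W a b c) = K"
    and nonneg: "\<And>a b c. W a b c \<ge> 0" and "K > 0" "finite U" "U \<noteq> {}"
  obtains a b c where "a \<in> U" "b \<in> U" "c \<in> U" "W a b c > 0"
    "sum F U + sum G U + sum H U \<le> real (card U) * (F a + G b + H c)"
proof (rule ccontr)
  assume "\<not> thesis"
  with that have less: "real (card U) * (F a + G b + H c) < sum F U + sum G U + sum H U"
    if "a \<in> U" "b \<in> U" "c \<in> U" "W a b c > 0" for a b c using that by force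
  define S where "S = (sum F U + sum G U + sum H U) / real (card U)"
  have card: "real (card U) > 0" using assms by (simp add: card_gt_0_iff)
  have less': "F a + G b + H c < S" if "a \<in> U" "b \<in> U" "c \<in> U" "W a b c > 0" for a b c
    using less[OF that] card by (simp add: S_def field_simps)
  let ?D = "\<lambda>a b c. W a b c * (S - (F a + G b + H c))"
  have D: "?D a b c \<ge> 0" if "a \<in> U" "b \<in> U" "c \<in> U" for a b c
    using less'[OF that] nonneg[of a b c] by (cases "W a b c = 0") auto
  have weighted: "(\<Sum>a\<in>U. \<Sum>b\<in>U. \<Sum>c\<in>U. W a b c * (F a + G b + H c))
    = K * (sum F U + sum G U + sum H U)"
    by (rule sum_weighted_triples) (fact sym marg)+
  have "(\<Sum>a\<in>U. \<Sum>b\<in>U. \<Sum>c\<in>U. ?D a b c)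
     = (\<Sum>a\<in>U. \<Sum>b\<in>U. \<Sum>c\<in>U. W a b c * S) - K * (sum F U + sum G U + sum H U)"
    unfolding right_diff_distrib[of "W _ _ _"] sum_subtractf weighted by (rule refl)
  \<comment> \<open>The total weight is \<open>card U * K\<close>, so the weighted deficits from
    \<open>S\<close> cancel exactly.\<close>
  also have "(\<Sum>a\<in>U. \<Sum>b\<in>U. \<Sum>c\<in>U. W a b c * S) = real (card U) * K * S"
    by (simp add: sum_distrib_right[symmetric] marg)
  also have "\<dots> - K * (sum F U + sum G U + sum H U) = 0"
    using card by (simp add: S_def)
  finally have zero: "(\<Sum>a\<in>U. \<Sum>b\<in>U. \<Sum>c\<in>U. ?D a b c) = 0" .
  have "W a b c = 0" if abc: "a \<in> U" "b \<in> U" "c \<in> U" for a b c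
  proof -
    have "(\<Sum>b\<in>U. \<Sum>c\<in>U. ?D a b c) = 0"
      using zero abc by (subst (asm) sum_nonneg_eq_0_iff) (auto intro!: sum_nonneg D \<open>finite U\<close>)
    hence "(\<Sum>c\<in>U. ?D a b c) = 0"
      using abc by (subst (asm) sum_nonneg_eq_0_iff) (auto intro!: sum_nonneg D \<open>finite U\<close>)
    hence "?D a b c = 0"
      using abc by (subst (asm) sum_nonneg_eq_0_iff) (auto intro!: D \<open>finite U\<close>)
    thus ?thesis using less'[OF abc] nonneg[of a b c] by force
  qed
  moreover obtain a where "a \<in> U" using assms by blast
  ultimately show False using marg[of a] \<open>K > 0\<close> by simp
qed

section \<open>Prime moduli at least 5\<close>

text \<open>\<open>exists_triple_ge_average\<close> applies to a weight supported on the solutions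
  of \<open>a + b + c = x\<close>; the work lies in showing that its marginal at \<open>a\<close>
  does not depend on \<open>a\<close>. The bound \<open>p \<ge> 5\<close> keeps the weight
  nonnegative, as at most 3 is subtracted from \<open>p - 1\<close>.\<close>

lemma ternary_average_attained_prime:
  fixes p :: int
  assumes p: "prime p" "p \<ge> 5"
  shows "ternary_average_attained p"
  unfolding ternary_average_attained_def
proof (intro allI)
  fix F G H :: "int \<Rightarrow> real" and x0
  let ?U = "units_mod p"
  have U: "?U = {0<..<p}" using p units_mod_prime by blast
  define x where "x = x0 mod p"
  have x: "0 \<le> x" "x < p" using p by (auto simp: x_def)
  \<comment> \<open>With all weights equal the marginal at \<open>x\<close> would be too large, since \<open>b + c = 0\<close> has \<open>p - 1\<close>
    solutions in units and any other value of \<open>b + c\<close> has \<open>p - 2\<close>.\<close>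
  define W where "W a b c = (if [a + b + c = x] (mod p)
     then real_of_int (p - 1) - of_bool (a = x) - of_bool (b = x) - of_bool (c = x) else 0)"
    for a b c
  define K where "K = real_of_int ((p - 1) * (p - 2) - 2 * of_bool (x \<noteq> 0))"
  have marg: "(\<Sum>b\<in>?U. \<Sum>c\<in>?U. W a b c) = K" if a: "a \<in> ?U" for a
  proof -
    \<comment> \<open>The units \<open>b\<close> for which the forced third entry
      \<open>(x - a - b) mod p\<close> is nonzero, hence a unit.\<close>
    define B where "B = ?U - {(x - a) mod p}"
    have cond: "[a + b + c = x] (mod p) \<longleftrightarrow> c = (x - a - b) mod p" if "c \<in> ?U" for b c
    proof -
      have "[a + b + c = x] (mod p) \<longleftrightarrow> [c = x - a - b] (mod p)"
        by (simp add: cong_iff_dvd_diff algebra_simps)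
      thus ?thesis using that by (auto simp: cong_def U)
    qed
    have inner: "(\<Sum>c\<in>?U. W a b c) = (if b \<in> B
        then real_of_int (p - 1) - of_bool (a = x) - of_bool (b = x) - of_bool (b = p - a) else 0)"
      if b: "b \<in> ?U" for b
    proof -
      define c where "c = (x - a - b) mod p"
      have c0: "c = 0 \<longleftrightarrow> b = (x - a) mod p"
      proof -
        have "c = 0 \<longleftrightarrow> [b = x - a] (mod p)"
          by (auto simp: c_def cong_iff_dvd_diff mod_eq_0_iff_dvd dvd_diff_commute)
        thus ?thesis using b by (auto simp: cong_def U)
      qed
      have cx: "c = x \<longleftrightarrow> b = p - a"
      proof -
        have "c = x \<longleftrightarrow> [x - a - b = x] (mod p)"
          using x by (auto simp: c_def cong_def)
        also have "\<dots> \<longleftrightarrow> p dvd a + b"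
          by (simp add: cong_iff_dvd_diff) (metis dvd_minus_iff minus_add_distrib diff_conv_add_uminus)
        also have "\<dots> \<longleftrightarrow> b = p - a"
        proof
          assume "p dvd a + b"
          then obtain k where k: "a + b = p * k" by (auto simp: dvd_def)
          \<comment> \<open>Since \<open>0 < a + b < 2 * p\<close>, the only multiple of
            \<open>p\<close> that \<open>a + b\<close> can equal is \<open>p\<close> itself.\<close>
          have "0 < p * k" "p * k < p * 2" using a b by (auto simp: U simp flip: k)
          hence "0 < k" "k < 2" using p(2) by (auto simp: zero_less_mult_iff mult_less_cancel_left)
          hence "k = 1" by simp
          thus "b = p - a" using k by simp
        qed auto
        finally show ?thesis .
      qed
      have "0 \<le> c" "c < p" using p by (auto simp: c_def)
      hence cU: "c \<in> ?U \<longleftrightarrow> b \<in> B" using b c0 by (auto simp: U B_def)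
      have "(\<Sum>c'\<in>?U. W a b c') = (\<Sum>c'\<in>?U. if c' = c then
          real_of_int (p - 1) - of_bool (a = x) - of_bool (b = x) - of_bool (c = x) else 0)"
        by (rule sum.cong) (auto simp: W_def cond c_def)
      thus ?thesis by (simp add: cU cx)
    qed
    have "(\<Sum>b\<in>?U. \<Sum>c\<in>?U. W a b c)
        = (\<Sum>b\<in>B. real_of_int (p - 1) - of_bool (a = x) - of_bool (b = x) - of_bool (b = p - a))"
    proof -
      have "?U \<inter> {b. b \<in> B} = B" by (auto simp: B_def)
      thus ?thesis by (simp only: inner sum.If_cases finite_units_mod cong: sum.cong) simp
    qed
    also have "\<dots> = real (card B) * (real_of_int (p - 1) - of_bool (a = x))
        - of_bool (x \<in> B) - of_bool (p - a \<in> B)"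
      by (simp add: sum_subtractf of_bool_def B_def)
    also have "\<dots> = K"
    \<comment> \<open>If \<open>a = x\<close>, all \<open>p - 1\<close> units \<open>b\<close> occur
      and each loses 1 in weight; otherwise one \<open>b\<close> is excluded and no such loss
      occurs. Either way the main term is \<open>(p - 1) * (p - 2)\<close>, and the corrections for
      \<open>b = x\<close> and \<open>c = x\<close> cost 1 each exactly when
      \<open>x \<noteq> 0\<close>.\<close>
    proof (cases "a = x")
      case True
      hence "B = ?U" "x \<noteq> 0" using a by (auto simp: B_def U)
      moreover have "p - a \<in> ?U" using a by (auto simp: U)
      ultimately show ?thesis using True a p by (simp add: K_def U algebra_simps)
    next
      case False
      have ne: "(x - a) mod p \<noteq> 0"
      proof
        assume "(x - a) mod p = 0"
        hence "[x = a] (mod p)" by (simp add: cong_iff_dvd_diff mod_eq_0_iff_dvd)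
        thus False using False x a by (simp add: cong_def U)
      qed
      have "0 \<le> (x - a) mod p" "(x - a) mod p < p" using p by auto
      with ne have mem: "(x - a) mod p \<in> ?U" by (auto simp: U)
      have card: "real (card B) = real_of_int (p - 2)"
        using p mem by (simp add: B_def U)
      have xB: "x \<in> B \<longleftrightarrow> x \<noteq> 0"
      proof -
        have "x \<noteq> (x - a) mod p"
        proof
          assume "x = (x - a) mod p"
          hence "[x = x - a] (mod p)" using x by (simp add: cong_def)
          hence "p dvd a" by (simp add: cong_iff_dvd_diff)
          thus False using a by (auto simp: U dest: zdvd_imp_le)
        qed
        thus ?thesis using x by (auto simp: B_def U)
      qed
      have paB: "p - a \<in> B \<longleftrightarrow> x \<noteq> 0"
      proof -
        have "p - a = (x - a) mod p \<longleftrightarrow> [p - a = x - a] (mod p)"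
          using a mod_pos_pos_trivial[of "p - a" p] by (simp add: cong_def U del: minus_mod_self1)
        also have "\<dots> \<longleftrightarrow> p dvd x"
          by (simp add: cong_iff_dvd_diff dvd_diff_right_iff)
        also have "\<dots> \<longleftrightarrow> x = 0" using x by (auto dest: zdvd_imp_le)
        finally show ?thesis using a by (auto simp: B_def U)
      qed
      show ?thesis by (simp add: card xB paB K_def False algebra_simps)
    qed
    finally show ?thesis .
  qed
  \<comment> \<open>At most 2 is subtracted from this product in \<open>K\<close>.\<close>
  have "(p - 1) * (p - 2) \<ge> 4 * 3" using p by (intro mult_mono) auto
  hence K: "K > 0" unfolding K_def by (simp only: of_int_0_less_iff) (simp add: of_bool_def)
  have sym: "W a b c = W b a c" "W a b c = W a c b" for a b c
    by (auto simp: W_def add_ac)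
  have nonneg: "W a b c \<ge> 0" for a b c
    using p by (auto simp: W_def of_bool_def)
  obtain a b c where abc: "a \<in> ?U" "b \<in> ?U" "c \<in> ?U" "W a b c > 0"
    "sum F ?U + sum G ?U + sum H ?U \<le> real (card ?U) * (F a + G b + H c)"
    using exists_triple_ge_average[of W, OF sym marg nonneg K finite_units_mod] p
      units_mod_nonempty[of p] by (metis not_less order.strict_trans2 zero_less_numeral)
  \<comment> \<open>Positive weight rules out the \<open>else\<close> branch of \<open>W\<close>, so
    the triple has the required sum.\<close>
  hence "[a + b + c = x0] (mod p)"
    by (auto simp: W_def x_def cong_def split: if_splits)
  with abc show "\<exists>a\<in>?U. \<exists>b\<in>?U. \<exists>c\<in>?U. [a + b + c = x0] (mod p) \<and>
      sum F ?U + sum G ?U + sum H ?U \<le> real (card ?U) * (F a + G b + H c)" by blast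
qed

section \<open>Squarefree moduli coprime to 6\<close>

text \<open>Prime factors are split off one at a time: coprimality to 6 makes each at least 5, and
  squarefreeness makes it coprime to its cofactor.\<close>

lemma ternary_average_attained_squarefree:
  fixes n :: int
  assumes "n > 0" "squarefree n" "coprime n 6"
  shows "ternary_average_attained n"
  using assms
proof (induction "nat n" arbitrary: n rule: less_induct)
  case less
  show ?case
  proof (cases "n = 1")
    case True
    thus ?thesis by (simp add: ternary_average_attained_1)
  next
    case False
    then obtain p where p: "prime p" "p dvd n"
      using less.prems by (metis prime_divisor_exists zdvd1_eq abs_of_pos less_irrefl)
    then obtain k where k: "n = p * k" by (auto simp: dvd_def)
    have p0: "p > 1" using p(1) prime_gt_1_int by blast
    have k0: "k > 0" using k p0 less.prems(1) by (simp add: zero_less_mult_iff)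
    have p5: "p \<ge> 5"
    proof (rule ccontr)
      assume "\<not> p \<ge> 5"
      with p0 consider "p = 2" | "p = 3" | "p = 4" by linarith
      moreover have "\<not> p dvd 6"
        using p less.prems(3) by (metis coprime_common_divisor not_prime_unit)
      moreover have "\<not> prime (4::int)"
        using prime_odd_int[of 4] by auto
      ultimately show False using p(1) by cases auto
    qed
    have cop: "coprime p k" "squarefree k" using less.prems(2) k squarefree_mult_imp_coprime
      by (blast, metis squarefree_multD(2))
    have "ternary_average_attained k"
    proof (rule less.hyps)
      show "nat k < nat n" using k k0 p0 by simp
      show "coprime k 6" using less.prems(3) k by simp
    qed (use k0 cop in auto)
    thus ?thesis unfolding k using ternary_average_attained_mult[of p k]
      ternary_average_attained_prime[OF p(1) p5] cop k0 p0 by auto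
  qed
qed

section \<open>Passing from m / 3 to m\<close>

theorem proposition1p6:
  fixes m :: int and f :: "int \<Rightarrow> real" and \<alpha> \<alpha>\<^sub>1 \<alpha>\<^sub>2 :: real
  assumes "m > 0" and "odd m" and "squarefree m" and "3 dvd m"
    and "f \<in> reduced_residues m \<rightarrow> {0<..1}"
    and "\<alpha> = average f (reduced_residues m)"
    and "\<alpha>\<^sub>1 = average f (reduced_residues_mod3 m 1)"
    and "\<alpha>\<^sub>2 = average f (reduced_residues_mod3 m 2)"
    and "2 * \<alpha>\<^sub>1 + \<alpha>\<^sub>2 > 3 / 2"
    and "2 * \<alpha>\<^sub>2 + \<alpha>\<^sub>1 > 3 / 2"
  shows "\<forall>x \<in> carrier (residue_ring m).
    \<exists>a\<^sub>1 \<in> reduced_residues m. \<exists>a\<^sub>2 \<in> reduced_residues m. \<exists>a\<^sub>3 \<in> reduced_residues m.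
      x = a\<^sub>1 \<oplus>\<^bsub>residue_ring m\<^esub> a\<^sub>2 \<oplus>\<^bsub>residue_ring m\<^esub> a\<^sub>3
      \<and> f a\<^sub>1 + f a\<^sub>2 + f a\<^sub>3 > 3 / 2"
proof
  fix x assume "x \<in> carrier (residue_ring m)"
  hence x: "0 \<le> x" "x < m" by (auto simp: residue_ring_def)
  obtain k where k: "m = 3 * k" using assms(4) by (auto simp: dvd_def)
  have k0: "k > 0" using k assms(1) by simp
  have U: "reduced_residues m = units_mod (3 * k)"
    using reduced_residues_eq_units_mod[of m] k k0 by simp
  have cop: "coprime 3 k" using assms(3) k squarefree_mult_imp_coprime by blast
  have "odd k" using assms(2) k by simp
  hence "coprime k 2" by (simp add: coprime_right_2_iff_odd)
  hence "coprime k (2 * 3)" using cop by (simp only: coprime_mult_right_iff coprime_commute)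
  hence k6: "ternary_average_attained k"
    using ternary_average_attained_squarefree[OF k0] assms(3) k squarefree_multD(2) by auto
  have U3: "units_mod 3 = {1, 2}" by (subst units_mod_prime) auto
  obtain c where c: "\<And>i j. i \<in> units_mod 3 \<Longrightarrow> j \<in> units_mod k \<Longrightarrow>
      c i j \<in> units_mod (3 * k) \<and> c i j mod 3 = i \<and> c i j mod k = j"
    and bij: "bij_betw (\<lambda>(i, j). c i j) (units_mod 3 \<times> units_mod k) (units_mod (3 * k))"
    using units_mod_mult_crt[of 3 k] k0 cop by auto
  define A where "A i = average f (reduced_residues_mod3 m i)" for i
  let ?N = "real (card (units_mod k))"
  have N: "?N > 0" using units_mod_nonempty[OF k0] by (simp add: card_gt_0_iff)
  \<comment> \<open>For fixed \<open>i\<close>, the map \<open>c i\<close> parametrises the units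
    modulo \<open>m\<close> in the class of \<open>i\<close> modulo 3 by the units modulo
    \<open>k\<close>, so all these classes have \<open>?N\<close> elements.\<close>
  have sum_A: "(\<Sum>j\<in>units_mod k. f (c i j)) = ?N * A i" if i: "i \<in> units_mod 3" for i
  proof -
    have i3: "i mod 3 = i" using i U3 by auto
    have "bij_betw (c i) (units_mod k) (reduced_residues_mod3 m i)"
      unfolding bij_betw_def
    proof
      show "inj_on (c i) (units_mod k)" by (rule inj_on_inverseI[of _ "\<lambda>r. r mod k"]) (use c i in auto)
      show "c i ` units_mod k = reduced_residues_mod3 m i"
      proof
        show "c i ` units_mod k \<subseteq> reduced_residues_mod3 m i"
          using c[OF i] i3 by (auto simp: reduced_residues_mod3_def U cong_def)
        show "reduced_residues_mod3 m i \<subseteq> c i ` units_mod k"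
        proof
          fix r assume "r \<in> reduced_residues_mod3 m i"
          hence r: "r \<in> units_mod (3 * k)" "r mod 3 = i"
            using i3 by (auto simp: reduced_residues_mod3_def U cong_def)
          then obtain i' j where "i' \<in> units_mod 3" "j \<in> units_mod k" "r = c i' j"
            using bij_betw_imp_surj_on[OF bij] by force
          thus "r \<in> c i ` units_mod k" using c r by auto
        qed
      qed
    qed
    hence "sum f (reduced_residues_mod3 m i) = (\<Sum>j\<in>units_mod k. f (c i j))"
      "card (reduced_residues_mod3 m i) = card (units_mod k)"
      by (auto simp: sum.reindex_bij_betw bij_betw_same_card)
    thus ?thesis using N by (simp add: A_def average_def)
  qed
  have A: "2 * A 1 + A 2 > 3 / 2" "2 * A 2 + A 1 > 3 / 2"
    using assms by (auto simp: A_def)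
  \<comment> \<open>The classes 1, 1, 2 add up to 1 modulo 3 and the classes 2, 2, 1 to 2, which
    matches the two hypotheses. For \<open>x\<close> divisible by 3 the classes must be equal;
    adding the hypotheses gives \<open>A 1 + A 2 > 1\<close>, so one of the averages exceeds
    1/2.\<close>
  have "\<exists>i\<in>{1,2}. \<exists>j\<in>{1,2}. \<exists>l\<in>{1,2}. [i + j + l = x] (mod 3) \<and> A i + A j + A l > 3 / 2"
  proof -
    consider "x mod 3 = 0" | "x mod 3 = 1" | "x mod 3 = 2"
      using pos_mod_bound[of 3 x] pos_mod_sign[of 3 x] by linarith
    thus ?thesis
    proof cases
      case 1
      have "A 1 > 1 / 2 \<or> A 2 > 1 / 2" using A by linarith
      thus ?thesis using 1 by (auto simp: cong_def)
    next
      case 2 thus ?thesis using A by (auto simp: cong_def)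
    next
      case 3 thus ?thesis using A by (auto simp: cong_def)
    qed
  qed
  then obtain i j l where i: "i \<in> units_mod 3" "j \<in> units_mod 3" "l \<in> units_mod 3"
    "[i + j + l = x] (mod 3)" "A i + A j + A l > 3 / 2"
    unfolding U3 by blast
  \<comment> \<open>The residues modulo 3 are now fixed, and the averaging property modulo
    \<open>k\<close> chooses one element in each of the three classes.\<close>
  obtain r s t where r: "r \<in> units_mod k" "s \<in> units_mod k" "t \<in> units_mod k"
    "[r + s + t = x] (mod k)"
    "?N * A i + ?N * A j + ?N * A l \<le> ?N * (f (c i r) + f (c j s) + f (c l t))"
    using ternary_average_attainedE[OF k6, of x "\<lambda>u. f (c i u)" "\<lambda>u. f (c j u)" "\<lambda>u. f (c l u)"]
    by (auto simp: sum_A i)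
  have "?N * (A i + A j + A l) \<le> ?N * (f (c i r) + f (c j s) + f (c l t))"
    using r(5) by (simp add: distrib_left)
  hence "f (c i r) + f (c j s) + f (c l t) > 3 / 2"
    using N i(5) by simp
  moreover have "[c i r + c j s + c l t = i + j + l] (mod 3)"
    "[c i r + c j s + c l t = r + s + t] (mod k)"
    using c r(1-3) i(1-3) by (auto intro!: cong_add simp: cong_def[of "c _ _"] units_mod_def)
  hence "[c i r + c j s + c l t = x] (mod 3 * k)"
    using r(4) i(4) cop by (meson coprime_cong_mult cong_trans)
  hence "x = c i r \<oplus>\<^bsub>residue_ring m\<^esub> c j s \<oplus>\<^bsub>residue_ring m\<^esub> c l t"
    using x by (simp add: residue_ring_def cong_def k mod_add_left_eq)
  ultimately show "\<exists>a\<^sub>1 \<in> reduced_residues m. \<exists>a\<^sub>2 \<in> reduced_residues m. \<exists>a\<^sub>3 \<in> reduced_residues m.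
      x = a\<^sub>1 \<oplus>\<^bsub>residue_ring m\<^esub> a\<^sub>2 \<oplus>\<^bsub>residue_ring m\<^esub> a\<^sub>3
      \<and> f a\<^sub>1 + f a\<^sub>2 + f a\<^sub>3 > 3 / 2"
    unfolding U using c r i by blast
qed

end
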